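(* Let $d$ be a positive integer. (1) Suppose $d$ is odd. Then the real loci of the curves $$(X_0^d+X_1^d+X_2^d=0)\quad\text{and}\quad (X_0^d+(X_1+\sqrt{-1}\,X_2)^d+(X_1-\sqrt{-1}\,X_2)^d=0)$$ in $\mathbb{P}^2_{\mathbb{R}}$ are both homeomorphic to $\mathbb{P}^1(\mathbb{R})$. (2) Suppose $d$ is even. Then, for the following curves in $\mathbb{P}^2_{\mathbb{R}}$: - the real locus of $(X_0^d+X_1^d+X_2^d=0)$ is empty; - the real locus of $(-X_0^d+X_1^d+X_2^d=0)$ is homeomorphic to $S^1$; - the real locus of $(X_0^d+(X_1+\sqrt{-1}\,X_2)^d+(X_1-\sqrt{-1}\,X_2)^d=0)$ is homeomorphic to a disjoint union $S^1\sqcup\cdots\sqcup S^1$ of $\frac d2$ copies of $S^1$.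
   Context: The real locus of a real variety is its set of $\mathbb{R}$-points with the Euclidean topology. The displayed equations involving $\sqrt{-1}$ have real coefficients once expanded. *)

theory Defs
  imports "HOL-Analysis.Analysis"
begin

text \<open>A point of a real projective space is a line through the origin, so that the projective
  space of \<open>real^2\<close> is \<open>P\<^sup>1(\<real>)\<close> and that of \<open>real^3\<close> is \<open>P\<^sup>2(\<real>)\<close>.\<close>

definition proj_point :: "'a::real_vector \<Rightarrow> 'a set" where
  "proj_point v = span {v}"

text \<open>The Euclidean topology on the set of real points is the quotient topology from the nonzero
  vectors (see \<open>quotient_map_proj_point\<close>).\<close>

definition real_projective_space :: "'a::real_normed_vector set topology" where
  "real_projective_space =
     topology (\<lambda>U. U \<subseteq> proj_point ` (- {0}) \<and> openin (top_of_set (- {0})) {v \<in> - {0}. proj_point v \<in> U})"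

lemma openin_real_projective_space:
  "openin real_projective_space U \<longleftrightarrow>
     U \<subseteq> proj_point ` (- {0}) \<and> openin (top_of_set (- {0})) {v \<in> - {0}. proj_point v \<in> U}"
proof -
  let ?P = "\<lambda>U::'a set set. U \<subseteq> proj_point ` (- {0}) \<and> openin (top_of_set (- {0})) {v \<in> - {0}. proj_point v \<in> U}"
  have "istopology ?P"
    unfolding istopology_def
  proof (intro conjI allI impI)
    fix S T assume S: "?P S" and T: "?P T"
    have eq: "{v \<in> - {0}. proj_point v \<in> S \<inter> T} =
        {v \<in> - {0}. proj_point v \<in> S} \<inter> {v \<in> - {0}. proj_point v \<in> T}"
      by auto
    show "S \<inter> T \<subseteq> proj_point ` (- {0})" using S by blast
    show "openin (top_of_set (- {0})) {v \<in> - {0}. proj_point v \<in> S \<inter> T}"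
      unfolding eq using S T by (blast intro: openin_Int)
  next
    fix \<K> assume K: "\<forall>K\<in>\<K>. ?P K"
    have eq: "{v \<in> - {0}. proj_point v \<in> \<Union>\<K>} = \<Union> ((\<lambda>K. {v \<in> - {0}. proj_point v \<in> K}) ` \<K>)"
      by auto
    show "\<Union>\<K> \<subseteq> proj_point ` (- {0})" using K by blast
    show "openin (top_of_set (- {0})) {v \<in> - {0}. proj_point v \<in> \<Union>\<K>}"
      unfolding eq using K by (intro openin_Union) blast
  qed
  then show ?thesis
    by (simp add: real_projective_space_def topology_inverse')
qed

lemma topspace_real_projective_space: "topspace real_projective_space = proj_point ` (- {0})"
proof -
  have "{v \<in> - {0::'a}. proj_point v \<in> proj_point ` (- {0})} = - {0}"
    by auto
  then have "openin real_projective_space (proj_point ` (- {0::'a}))"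
    by (simp add: openin_real_projective_space)
  then show ?thesis
    by (metis openin_real_projective_space openin_topspace openin_subset subset_antisym)
qed

lemma quotient_map_proj_point: "quotient_map (top_of_set (- {0})) real_projective_space proj_point"
  unfolding quotient_map_def
  by (auto simp: topspace_real_projective_space openin_real_projective_space)

text \<open>The equation may have coefficients in an extension of the reals such as \<open>complex\<close>; it is
  evaluated only at real vectors. For a homogeneous \<open>F\<close> of positive degree, whether \<open>F v = 0\<close>
  depends only on \<open>proj_point v\<close>.\<close>

definition real_locus :: "('a::real_normed_vector \<Rightarrow> 'b::zero) \<Rightarrow> 'a set topology" where
  "real_locus F = subtopology real_projective_space (proj_point ` {v. v \<noteq> 0 \<and> F v = 0})"

lemma proj_point_in_real_locus_iff:
  fixes F :: "'a::real_normed_vector \<Rightarrow> 'b::real_algebra_1"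
  assumes hom: "\<And>c v. F (c *\<^sub>R v) = c ^ d *\<^sub>R F v" and "d > 0" "v \<noteq> 0"
  shows "proj_point v \<in> topspace (real_locus F) \<longleftrightarrow> F v = 0"
proof
  assume "proj_point v \<in> topspace (real_locus F)"
  then obtain w where w: "F w = 0" "span {v} = span {w}"
    by (auto simp: real_locus_def proj_point_def)
  then have "v \<in> span {w}"
    by (metis insertI1 span_base)
  then obtain c where "v = c *\<^sub>R w"
    by (auto simp: span_singleton)
  with w hom show "F v = 0" by simp
qed (use \<open>v \<noteq> 0\<close> in \<open>auto simp: real_locus_def topspace_real_projective_space\<close>)

text \<open>The homogeneous coordinates \<open>X\<^sub>0, X\<^sub>1, X\<^sub>2\<close> are the components \<open>x $ 0, x $ 1, x $ 2\<close>.
  The numerals of the index type \<open>3\<close> are read modulo 3, so \<open>0, 1, 2\<close> are its three distinct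
  elements.\<close>

lemma UNIV_3_coordinates: "(UNIV :: 3 set) = {0, 1, 2}" "distinct [0, 1, 2 :: 3]"
proof -
  have "(3::3) = 0" by simp
  then show "(UNIV :: 3 set) = {0, 1, 2}" using UNIV_3 by auto
qed simp

definition fermat_form :: "nat \<Rightarrow> real^3 \<Rightarrow> real" where
  "fermat_form d x = (x $ 0) ^ d + (x $ 1) ^ d + (x $ 2) ^ d"

definition signed_fermat_form :: "nat \<Rightarrow> real^3 \<Rightarrow> real" where
  "signed_fermat_form d x = - ((x $ 0) ^ d) + (x $ 1) ^ d + (x $ 2) ^ d"

definition twisted_fermat_form :: "nat \<Rightarrow> real^3 \<Rightarrow> complex" where
  "twisted_fermat_form d x =
     (of_real (x $ 0)) ^ d + (of_real (x $ 1) + \<i> * of_real (x $ 2)) ^ d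
                           + (of_real (x $ 1) - \<i> * of_real (x $ 2)) ^ d"

lemma twisted_fermat_form_real: "twisted_fermat_form d x \<in> \<real>"
  unfolding Reals_cnj_iff by (simp add: twisted_fermat_form_def)

lemma fermat_form_homogeneous:
  "fermat_form d (c *\<^sub>R x) = c ^ d *\<^sub>R fermat_form d x"
  "signed_fermat_form d (c *\<^sub>R x) = c ^ d *\<^sub>R signed_fermat_form d x"
  by (simp_all add: fermat_form_def signed_fermat_form_def power_mult_distrib algebra_simps)

lemma twisted_fermat_form_homogeneous:
  "twisted_fermat_form d (c *\<^sub>R x) = c ^ d *\<^sub>R twisted_fermat_form d x"
proof -
  have *: "(of_real (c * a) + \<i> * of_real (c * b)) ^ d = of_real c ^ d * (of_real a + \<i> * of_real b) ^ d"
          "(of_real (c * a) - \<i> * of_real (c * b)) ^ d = of_real c ^ d * (of_real a - \<i> * of_real b) ^ d" for a b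
    by (simp_all add: algebra_simps flip: power_mult_distrib)
  show ?thesis
    unfolding twisted_fermat_form_def vector_scaleR_component real_scaleR_def *
    by (simp add: scaleR_conv_of_real power_mult_distrib distrib_left)
qed

definition circle :: "(real^2) topology" where
  "circle = top_of_set (sphere 0 1)"

end

theory Submission
  imports Defs
begin

text \<open>Real projective space is compact and Hausdorff, so every continuous injective parametrization
  of a real locus by a compact space is a homeomorphism. For odd \<open>d\<close> the curves are graphs
  \<open>X\<^sub>0 = h (X\<^sub>1, X\<^sub>2)\<close> with \<open>h\<close> homogeneous of degree one, hence parametrized by \<open>P\<^sup>1(\<real>)\<close>. For even
  \<open>d\<close> the signed curve is parametrized by the unit circle of \<open>(X\<^sub>1, X\<^sub>2)\<close> with \<open>X\<^sub>0 > 0\<close>, and the twisted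
  curve, in polar coordinates \<open>X\<^sub>0\<^sup>d = - 2 r\<^sup>d cos (d t)\<close>, has one oval over each of the \<open>d div 2\<close> arcs of
  \<open>[0, pi)\<close> on which \<open>cos (d t) \<le> 0\<close>.\<close>

section \<open>Real projective space\<close>

lemma proj_point_eq_iff:
  fixes u v :: "'a::real_vector"
  assumes "v \<noteq> 0"
  shows "proj_point u = proj_point v \<longleftrightarrow> (\<exists>c. c \<noteq> 0 \<and> u = c *\<^sub>R v)"
proof
  assume eq: "proj_point u = proj_point v"
  have "u \<in> proj_point u" "v \<in> proj_point v"
    by (auto simp: proj_point_def span_base)
  then have "u \<in> span {v}" "v \<in> span {u}"
    using eq by (auto simp: proj_point_def)
  then obtain c b where "u = c *\<^sub>R v" "v = b *\<^sub>R u"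
    unfolding span_singleton by blast
  with assms show "\<exists>c. c \<noteq> 0 \<and> u = c *\<^sub>R v"
    by (metis scaleR_zero_left scaleR_zero_right)
next
  assume "\<exists>c. c \<noteq> 0 \<and> u = c *\<^sub>R v"
  then obtain c where c: "c \<noteq> 0" "u = c *\<^sub>R v" by blast
  have "k *\<^sub>R u = (k * c) *\<^sub>R v" "k *\<^sub>R v = (k / c) *\<^sub>R u" for k
    using c by simp_all
  then show "proj_point u = proj_point v"
    unfolding proj_point_def span_singleton by (intro subset_antisym image_subsetI) (metis rangeI)+
qed

text \<open>The fibres of \<open>proj_point\<close> on nonzero vectors are the scaling orbits, so a
  scale-invariant map factors through the quotient.\<close>

lemma proj_point_lift:
  fixes g :: "'a::real_normed_vector \<Rightarrow> 'b"
  assumes cont: "continuous_map (top_of_set (- {0})) Z g"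
    and inv: "\<And>c v. \<lbrakk>c \<noteq> 0; v \<noteq> 0\<rbrakk> \<Longrightarrow> g (c *\<^sub>R v) = g v"
  obtains h where "continuous_map real_projective_space Z h" "\<And>v. v \<noteq> 0 \<Longrightarrow> h (proj_point v) = g v"
proof (rule quotient_map_lift_exists[OF quotient_map_proj_point cont])
  fix x y :: 'a
  assume "x \<in> topspace (top_of_set (- {0}))" "y \<in> topspace (top_of_set (- {0}))"
    "proj_point x = proj_point y"
  then show "g x = g y"
    using inv by (auto simp: proj_point_eq_iff)
next
  fix h assume "continuous_map real_projective_space Z h"
    "\<And>x. x \<in> topspace (top_of_set (- {0})) \<Longrightarrow> h (proj_point x) = g x"
  then show thesis
    by (intro that[of h]) auto
qed

text \<open>The functions \<open>[x] \<mapsto> \<bar>u \<bullet> x\<bar> / norm x\<close> separate points, by the equality case of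
  Cauchy--Schwarz.\<close>

lemma Hausdorff_real_projective_space:
  "Hausdorff_space (real_projective_space :: 'a::real_inner set topology)"
  unfolding Hausdorff_space_def
proof (intro allI impI)
  fix p q :: "'a set"
  assume pq: "p \<in> topspace real_projective_space \<and> q \<in> topspace real_projective_space \<and> p \<noteq> q"
  then obtain u v :: 'a where u: "u \<noteq> 0" "p = proj_point u" and v: "v \<noteq> 0" "q = proj_point v"
    by (auto simp: topspace_real_projective_space)
  let ?h = "\<lambda>x. \<bar>u \<bullet> x\<bar> / norm x"
  have cont: "continuous_map (top_of_set (- {0})) euclideanreal ?h"
    unfolding continuous_map_iff_continuous by (intro continuous_intros) auto
  obtain h where h: "continuous_map real_projective_space euclideanreal h"
    "\<And>x. x \<noteq> 0 \<Longrightarrow> h (proj_point x) = ?h x"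
    using proj_point_lift[OF cont] by (auto simp: abs_mult)
  have "h p \<noteq> h q"
  proof
    assume "h p = h q"
    \<comment> \<open>Testing against \<open>u\<close> itself gives \<open>h p = norm u\<close>, so
      \<open>h q\<close> can agree only in the equality case.\<close>
    then have "\<bar>u \<bullet> v\<bar> = norm u * norm v"
      using h(2) u v by (simp add: dot_square_norm power2_eq_square field_simps)
    then have "norm u *\<^sub>R v = norm v *\<^sub>R u \<or> norm u *\<^sub>R v = (- norm v) *\<^sub>R u"
      by (simp add: norm_cauchy_schwarz_abs_eq)
    then obtain c where c: "c \<noteq> 0" "norm u *\<^sub>R v = c *\<^sub>R u"
      using v(1) by (metis neg_equal_0_iff_equal norm_eq_zero)
    have "u = (norm u / c) *\<^sub>R v"
      using arg_cong[OF c(2), of "\<lambda>x. (1 / c) *\<^sub>R x"] c(1) by simp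
    then have "p = q"
      using u v c(1) proj_point_eq_iff[OF v(1), of u]
      by (metis divide_eq_0_iff norm_eq_zero)
    with pq show False by blast
  qed
  then obtain U V where UV: "open U" "open V" "h p \<in> U" "h q \<in> V" "U \<inter> V = {}"
    using hausdorff by meson
  let ?pre = "\<lambda>U. {x \<in> topspace real_projective_space. h x \<in> U}"
  have "openin real_projective_space (?pre U)" "openin real_projective_space (?pre V)"
    using UV h(1) by (auto intro: openin_continuous_map_preimage)
  moreover have "p \<in> ?pre U" "q \<in> ?pre V" "disjnt (?pre U) (?pre V)"
    using pq UV by (auto simp: disjnt_def)
  ultimately show "\<exists>U V. openin real_projective_space U \<and> openin real_projective_space V \<and>
      p \<in> U \<and> q \<in> V \<and> disjnt U V"
    by blast
qed

lemma continuous_map_proj_point: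
  fixes g :: "'x \<Rightarrow> 'a::real_normed_vector"
  assumes "continuous_map X euclidean g" "\<And>x. x \<in> topspace X \<Longrightarrow> g x \<noteq> 0"
  shows "continuous_map X real_projective_space (\<lambda>x. proj_point (g x))"
proof -
  have "continuous_map X (top_of_set (- {0})) g"
    using assms by (auto simp: continuous_map_in_subtopology)
  from continuous_map_compose[OF this quotient_imp_continuous_map[OF quotient_map_proj_point]]
  show ?thesis by (simp add: o_def)
qed

text \<open>The compact unit sphere meets every line through the origin, so its image is the whole
  space.\<close>

lemma compact_real_projective_space:
  "compact_space (real_projective_space :: 'a::euclidean_space set topology)"
proof -
  have "continuous_map (top_of_set (sphere 0 1)) real_projective_space (proj_point :: 'a \<Rightarrow> _)"
    by (rule continuous_map_proj_point) auto
  then have "compactin real_projective_space (proj_point ` sphere (0::'a) 1)"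
    by (rule image_compactin[rotated]) (simp add: compactin_subtopology)
  moreover have "proj_point ` sphere (0::'a) 1 = proj_point ` (- {0})"
  proof
    have sgn: "proj_point v = proj_point (sgn v)" "sgn v \<in> sphere 0 1" if "v \<noteq> 0" for v :: 'a
      using that
      by (auto simp: proj_point_eq_iff sgn_zero_iff norm_sgn sgn_div_norm intro!: exI[of _ "norm v"])
    show "proj_point ` (- {0}) \<subseteq> proj_point ` sphere (0::'a) 1"
    proof (rule image_subsetI)
      fix v :: 'a assume "v \<in> - {0}"
      then show "proj_point v \<in> proj_point ` sphere 0 1"
        using sgn[of v] by (intro image_eqI[where x = "sgn v"]) auto
    qed
  qed (intro image_mono, auto)
  ultimately show ?thesis
    by (simp add: compact_space_def topspace_real_projective_space)
qed

section \<open>Parametrizations of real loci\<close>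

lemma homeomorphic_real_locusI:
  fixes F :: "'a::real_inner \<Rightarrow> 'b::zero"
  assumes "compact_space X" "continuous_map X real_projective_space f"
    and im: "f ` topspace X = proj_point ` {v. v \<noteq> 0 \<and> F v = 0}"
    and "inj_on f (topspace X)"
  shows "real_locus F homeomorphic_space X"
proof -
  have "topspace (real_locus F) = proj_point ` {v. v \<noteq> 0 \<and> F v = 0}"
    by (auto simp: real_locus_def topspace_real_projective_space)
  moreover have "continuous_map X (real_locus F) f"
    unfolding real_locus_def using assms by (auto simp: continuous_map_in_subtopology)
  moreover have "Hausdorff_space (real_locus F)"
    unfolding real_locus_def by (intro Hausdorff_space_subtopology Hausdorff_real_projective_space)
  ultimately have "homeomorphic_map X (real_locus F) f"
    using assms by (intro continuous_imp_homeomorphic_map) auto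
  then show ?thesis
    using homeomorphic_map_imp_homeomorphic_space homeomorphic_space_sym by blast
qed

text \<open>For curves whose points have continuously chosen representative vectors
  \<open>g x\<close>: by \<open>inj\<close> and \<open>surj\<close>, the line through each nonzero
  zero of \<open>F\<close> contains \<open>g x\<close> for exactly one \<open>x\<close>.\<close>

lemma homeomorphic_real_locus_parametrization:
  fixes F :: "'a::real_inner \<Rightarrow> 'b::zero"
  assumes "compact_space X" "continuous_map X euclidean g"
    and zero: "\<And>x. x \<in> topspace X \<Longrightarrow> g x \<noteq> 0 \<and> F (g x) = 0"
    and inj: "\<And>x y c. \<lbrakk>x \<in> topspace X; y \<in> topspace X; c \<noteq> 0; g x = c *\<^sub>R g y\<rbrakk> \<Longrightarrow> x = y"
    and surj: "\<And>v. \<lbrakk>v \<noteq> 0; F v = 0\<rbrakk> \<Longrightarrow> \<exists>x\<in>topspace X. \<exists>c. c \<noteq> 0 \<and> v = c *\<^sub>R g x"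
  shows "real_locus F homeomorphic_space X"
proof (rule homeomorphic_real_locusI)
  show "continuous_map X real_projective_space (\<lambda>x. proj_point (g x))"
    using assms by (intro continuous_map_proj_point) auto
  show "inj_on (\<lambda>x. proj_point (g x)) (topspace X)"
    using zero inj by (auto simp: inj_on_def proj_point_eq_iff)
  show "(\<lambda>x. proj_point (g x)) ` topspace X = proj_point ` {v. v \<noteq> 0 \<and> F v = 0}"
  proof
    show "proj_point ` {v. v \<noteq> 0 \<and> F v = 0} \<subseteq> (\<lambda>x. proj_point (g x)) ` topspace X"
    proof safe
      fix v assume "v \<noteq> 0" "F v = 0"
      then obtain x c where "x \<in> topspace X" "c \<noteq> 0" "v = c *\<^sub>R g x"
        using surj by blast
      with zero have "proj_point v = proj_point (g x)"
        by (auto simp: proj_point_eq_iff)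
      with \<open>x \<in> topspace X\<close> show "proj_point v \<in> (\<lambda>x. proj_point (g x)) ` topspace X" by blast
    qed
  qed (use zero in auto)
qed fact

section \<open>Coordinates, and curves that are graphs over the projective line\<close>

definition coords :: "real \<Rightarrow> real \<Rightarrow> real \<Rightarrow> real^3" where
  "coords a b c = (\<chi> i. if i = 0 then a else if i = 1 then b else c)"

lemma coords_nth [simp]: "coords a b c $ 0 = a" "coords a b c $ 1 = b" "coords a b c $ 2 = c"
  using UNIV_3_coordinates(2) by (auto simp: coords_def)

lemma vec3_eq_iff: "x = y \<longleftrightarrow> x $ 0 = y $ 0 \<and> x $ 1 = y $ 1 \<and> x $ 2 = y $ 2" for x y :: "'a^3"
  using UNIV_3_coordinates(1) by (auto simp: vec_eq_iff) (metis UNIV_I insertE singletonD)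

lemma vec2_eq_iff: "x = y \<longleftrightarrow> x $ 1 = y $ 1 \<and> x $ 2 = y $ 2" for x y :: "'a^2"
  by (auto simp: vec_eq_iff forall_2)

lemma continuous_on_coords [continuous_intros]:
  assumes "continuous_on S f" "continuous_on S g" "continuous_on S h"
  shows "continuous_on S (\<lambda>x. coords (f x) (g x) (h x))"
proof -
  have "continuous_on S (\<lambda>x. if i = (0::3) then f x else if i = 1 then g x else h x)" for i
    using assms by (cases "i = 0"; cases "i = 1") simp_all
  then show ?thesis
    unfolding coords_def by (intro continuous_on_vec_lambda)
qed

text \<open>The graph map commutes with scaling, so it descends to projective spaces; its inverse
  forgets X_0.\<close>

lemma homeomorphic_real_locus_graph:
  fixes F :: "real^3 \<Rightarrow> 'b::zero" and h :: "real^2 \<Rightarrow> real"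
  assumes cont: "continuous_on UNIV h"
    and hom: "\<And>c v. h (c *\<^sub>R v) = c * h v"
    and F: "\<And>a v. F (coords a (v $ 1) (v $ 2)) = 0 \<longleftrightarrow> a = h v"
  shows "real_locus F homeomorphic_space (real_projective_space :: (real^2) set topology)"
proof -
  define G where "G v = coords (h v) (v $ 1) (v $ 2)" for v :: "real^2"
  have G_scale: "G (c *\<^sub>R v) = c *\<^sub>R G v" for c v
    by (simp add: G_def vec3_eq_iff hom)
  have G_inj: "G u = G v \<longleftrightarrow> u = v" for u v
    by (auto simp: G_def vec3_eq_iff simp flip: vec2_eq_iff)
  have G_nz: "G v \<noteq> 0" if "v \<noteq> 0" for v
    using that G_inj[of v 0] G_scale[of 0 0] by simp
  have "continuous_on (- {0}) G"
    unfolding G_def by (intro continuous_intros continuous_on_subset[OF cont]) auto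
  then have cG: "continuous_map (top_of_set (- {0})) real_projective_space (\<lambda>v. proj_point (G v))"
    using G_nz by (intro continuous_map_proj_point) auto
  obtain f where f: "continuous_map real_projective_space real_projective_space f"
    "\<And>x. x \<noteq> 0 \<Longrightarrow> f (proj_point x) = proj_point (G x)"
  proof (rule proj_point_lift[OF cG])
    show "proj_point (G (c *\<^sub>R v)) = proj_point (G v)" if "c \<noteq> 0" "v \<noteq> 0" for c v
      using that G_nz by (auto simp: proj_point_eq_iff G_scale)
  qed (rule that)
  show ?thesis
  proof (rule homeomorphic_real_locusI[OF compact_real_projective_space f(1)])
    show "inj_on f (topspace real_projective_space)"
      using f(2) G_nz
      by (auto simp: inj_on_def topspace_real_projective_space proj_point_eq_iff G_inj simp flip: G_scale)
    have "proj_point v \<in> f ` proj_point ` (- {0})" if v: "v \<noteq> 0" "F v = 0" for v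
    proof -
      define w :: "real^2" where "w = vector [v $ 1, v $ 2]"
      have "v = coords (v $ 0) (w $ 1) (w $ 2)"
        by (simp add: vec3_eq_iff w_def)
      then have "v = G w"
        using v(2) F[of "v $ 0" w] by (simp add: G_def)
      \<comment> \<open>The centre of projection [1 : 0 : 0] is off the curve: \<open>w = 0\<close>
        would give \<open>v = G 0 = 0\<close>.\<close>
      moreover from this v have "w \<noteq> 0"
        using G_scale[of 0 0] by auto
      ultimately show ?thesis
        using f(2)[of w] by (auto simp: image_iff)
    qed
    moreover have "F (G v) = 0" for v
      by (simp add: G_def F)
    ultimately show "f ` topspace real_projective_space = proj_point ` {v. v \<noteq> 0 \<and> F v = 0}"
      using f(2) G_nz by (auto simp: topspace_real_projective_space)
  qed
qed

section \<open>The forms\<close>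

text \<open>The last two summands are powers of conjugate numbers.\<close>

lemma twisted_fermat_form_Re:
  "twisted_fermat_form d x = of_real ((x $ 0) ^ d + 2 * Re (Complex (x $ 1) (x $ 2) ^ d))"
proof -
  let ?z = "Complex (x $ 1) (x $ 2)"
  have z: "complex_of_real (x $ 1) + \<i> * of_real (x $ 2) = ?z"
    "complex_of_real (x $ 1) - \<i> * of_real (x $ 2) = cnj ?z"
    by (simp_all add: complex_eq_iff)
  have "?z ^ d + cnj ?z ^ d = of_real (2 * Re (?z ^ d))"
    by (metis complex_add_cnj complex_cnj_power)
  then show ?thesis
    unfolding twisted_fermat_form_def z by (simp only: add.assoc of_real_add of_real_power)
qed

text \<open>De Moivre's formula. The radius \<open>r\<close> may be negative, as for the signed
  radii below, or zero, as at X_1 = X_2 = 0.\<close>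

lemma twisted_fermat_form_polar:
  assumes "x $ 1 = r * cos t" "x $ 2 = r * sin t"
  shows "twisted_fermat_form d x = of_real ((x $ 0) ^ d + 2 * r ^ d * cos (real d * t))"
proof -
  have "Complex (x $ 1) (x $ 2) = rcis r t"
    by (simp add: assms complex_eq_iff)
  then show ?thesis
    by (simp add: twisted_fermat_form_Re DeMoivre2)
qed

section \<open>Odd degree: both curves as graphs\<close>

text \<open>For odd \<open>d\<close>, \<open>root d\<close> inverts the \<open>d\<close>-th power on
  all of \<real>, so exactly one X_0 lies over each (X_1, X_2). The radicand has degree
  \<open>d\<close>, which makes its root homogeneous of degree one.\<close>

lemma fermat_locus_odd:
  assumes "odd d"
  shows "real_locus (fermat_form d) homeomorphic_space (real_projective_space :: (real^2) set topology)"
proof (rule homeomorphic_real_locus_graph)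
  let ?h = "\<lambda>v::real^2. root d (- ((v $ 1) ^ d + (v $ 2) ^ d))"
  show "continuous_on UNIV ?h"
    by (intro continuous_intros)
  show "?h (c *\<^sub>R v) = c * ?h v" for c v
  proof -
    have "- (((c *\<^sub>R v) $ 1) ^ d + ((c *\<^sub>R v) $ 2) ^ d) = c ^ d * - ((v $ 1) ^ d + (v $ 2) ^ d)"
      by (simp add: power_mult_distrib algebra_simps)
    then show ?thesis
      by (simp only: real_root_mult odd_real_root_power_cancel[OF assms])
  qed
  show "fermat_form d (coords a (v $ 1) (v $ 2)) = 0 \<longleftrightarrow> a = ?h v" for a v
  proof -
    have "a = root d y \<longleftrightarrow> a ^ d = y" for y
      using odd_real_root_power_cancel[OF assms, of a] odd_real_root_pow[OF assms, of y] by auto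
    then show ?thesis
      by (simp only: fermat_form_def coords_nth) linarith
  qed
qed

text \<open>The same argument for X_0^d = - 2 Re (z^d) with z = X_1 + \<i> X_2, since real scaling
  of z multiplies Re (z^d) by a \<open>d\<close>-th power.\<close>

lemma twisted_fermat_locus_odd:
  assumes "odd d"
  shows "real_locus (twisted_fermat_form d) homeomorphic_space
    (real_projective_space :: (real^2) set topology)"
proof (rule homeomorphic_real_locus_graph)
  let ?h = "\<lambda>v::real^2. root d (- (2 * Re (Complex (v $ 1) (v $ 2) ^ d)))"
  show "continuous_on UNIV ?h"
    unfolding Complex_eq by (intro continuous_intros)
  show "?h (c *\<^sub>R v) = c * ?h v" for c v
  proof -
    have "Complex ((c *\<^sub>R v) $ 1) ((c *\<^sub>R v) $ 2) = c *\<^sub>R Complex (v $ 1) (v $ 2)"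
      by (simp add: complex_eq_iff)
    then have "- (2 * Re (Complex ((c *\<^sub>R v) $ 1) ((c *\<^sub>R v) $ 2) ^ d)) =
        c ^ d * - (2 * Re (Complex (v $ 1) (v $ 2) ^ d))"
      by (simp only: scaleR_power scaleR_complex.sel)
    then show ?thesis
      by (simp only: real_root_mult odd_real_root_power_cancel[OF assms])
  qed
  show "twisted_fermat_form d (coords a (v $ 1) (v $ 2)) = 0 \<longleftrightarrow> a = ?h v" for a v
  proof -
    have "a = root d y \<longleftrightarrow> a ^ d = y" for y
      using odd_real_root_power_cancel[OF assms, of a] odd_real_root_pow[OF assms, of y] by auto
    then show ?thesis
      by (simp only: twisted_fermat_form_Re coords_nth of_real_eq_0_iff) linarith
  qed
qed

section \<open>Even degree: the two untwisted curves\<close>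

lemma fermat_locus_even:
  assumes "even d" "d > 0"
  shows "topspace (real_locus (fermat_form d)) = {}"
proof -
  have "v = 0" if "fermat_form d v = 0" for v
    using that assms
    by (simp add: fermat_form_def vec3_eq_iff add_nonneg_eq_0_iff zero_le_even_power)
  then show ?thesis
    by (auto simp: real_locus_def)
qed

lemma topspace_circle: "topspace circle = {v. (v $ 1)\<^sup>2 + (v $ 2)\<^sup>2 = 1}"
  by (auto simp: circle_def norm_vec_def L2_set_def sum_2)

lemma compact_circle: "compact_space circle"
  by (simp add: circle_def compact_space_subtopology)

lemma signed_fermat_locus_even:
  assumes "even d" "d > 0"
  shows "real_locus (signed_fermat_form d) homeomorphic_space circle"
proof (rule homeomorphic_real_locus_parametrization[OF compact_circle])
  let ?n = "\<lambda>v::real^2. (v $ 1) ^ d + (v $ 2) ^ d"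
  let ?g = "\<lambda>v::real^2. coords (root d (?n v)) (v $ 1) (v $ 2)"
  show "continuous_map circle euclidean ?g"
    unfolding circle_def by (auto intro!: continuous_intros)
  have n_nonneg: "?n v \<ge> 0" for v
    using assms by (simp add: zero_le_even_power)
  have n_pos: "?n v > 0" if "v \<in> topspace circle" for v
  proof -
    have "?n v \<noteq> 0"
      using that assms by (auto simp: topspace_circle add_nonneg_eq_0_iff zero_le_even_power)
    with n_nonneg[of v] show ?thesis by linarith
  qed
  show "?g x \<noteq> 0 \<and> signed_fermat_form d (?g x) = 0" if "x \<in> topspace circle" for x
    using n_pos[OF that] assms by (simp add: signed_fermat_form_def vec3_eq_iff)
  show "x = y" if xy: "x \<in> topspace circle" "y \<in> topspace circle" "c \<noteq> 0" "?g x = c *\<^sub>R ?g y" for x y c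
  proof -
    have eq: "x $ 1 = c * y $ 1" "x $ 2 = c * y $ 2" "root d (?n x) = c * root d (?n y)"
      using xy(4) by (auto simp: vec3_eq_iff)
    \<comment> \<open>Both pairs (X_1, X_2) are unit vectors, so \<open>c\<close> is 1 or -1; the
      positive X_0 coordinates exclude -1.\<close>
    have "1 = c\<^sup>2 * ((y $ 1)\<^sup>2 + (y $ 2)\<^sup>2)"
      using xy(1) by (simp add: topspace_circle eq power_mult_distrib algebra_simps)
    with xy(2) have "c\<^sup>2 = 1" by (simp add: topspace_circle)
    moreover have "c > 0"
      using eq(3) n_pos[OF xy(1)] n_pos[OF xy(2)] assms
      by (metis real_root_gt_zero zero_less_mult_pos2)
    ultimately have "c = 1" by (simp add: power2_eq_1_iff)
    with eq show ?thesis by (simp add: vec2_eq_iff)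
  qed
  show "\<exists>x\<in>topspace circle. \<exists>c. c \<noteq> 0 \<and> v = c *\<^sub>R ?g x" if v: "v \<noteq> 0" "signed_fermat_form d v = 0" for v
  proof -
    have v0: "(v $ 0) ^ d = (v $ 1) ^ d + (v $ 2) ^ d"
      using v(2) by (simp add: signed_fermat_form_def)
    define r where "r = sqrt ((v $ 1)\<^sup>2 + (v $ 2)\<^sup>2)"
    \<comment> \<open>On this curve X_1 = X_2 = 0 would force X_0 = 0.\<close>
    have "v $ 1 \<noteq> 0 \<or> v $ 2 \<noteq> 0"
      using v(1) v0 assms by (auto simp: vec3_eq_iff power_0_left)
    then have r: "r > 0"
      by (simp add: r_def sum_power2_gt_zero_iff)
    \<comment> \<open>The size of \<open>c\<close> puts \<open>x\<close> on the unit circle; its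
      sign makes \<open>v $ 0 / c\<close> nonnegative, hence the root that \<open>root d\<close>
      returns.\<close>
    define c where "c = (if v $ 0 \<ge> 0 then r else - r)"
    define x :: "real^2" where "x = vector [v $ 1 / c, v $ 2 / c]"
    have c: "c \<noteq> 0" "c\<^sup>2 = r\<^sup>2" "v $ 0 / c \<ge> 0"
      using r by (auto simp: c_def divide_nonpos_pos)
    have "(v $ 1)\<^sup>2 + (v $ 2)\<^sup>2 = c\<^sup>2"
      unfolding c(2) by (simp add: r_def)
    then have "x \<in> topspace circle"
      using c(1) by (simp add: topspace_circle x_def power_divide flip: add_divide_distrib)
    moreover have "?n x = (v $ 0 / c) ^ d"
      by (simp add: x_def power_divide v0 add_divide_distrib)
    then have "root d (?n x) = v $ 0 / c"
      using c(3) assms by (simp add: real_root_power_cancel)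
    then have "v = c *\<^sub>R ?g x"
      using c(1) by (simp add: vec3_eq_iff x_def)
    ultimately show ?thesis using c(1) by blast
  qed
qed

section \<open>The ovals of the twisted curve of even degree\<close>

lemma continuous_map_sum_topologyI:
  assumes "\<And>i. i \<in> I \<Longrightarrow> continuous_map (X i) Y (\<lambda>x. f (i, x))"
  shows "continuous_map (sum_topology X I) Y f"
  unfolding continuous_map_def openin_sum_topology
proof (intro conjI allI impI ballI)
  show "f \<in> topspace (sum_topology X I) \<rightarrow> topspace Y"
    using assms by (force simp: continuous_map_def)
  fix U i assume U: "openin Y U" and i: "i \<in> I"
  have "{x. (i, x) \<in> {x \<in> topspace (sum_topology X I). f x \<in> U}} = {x \<in> topspace (X i). f (i, x) \<in> U}"
    using i by auto
  then show "openin (X i) {x. (i, x) \<in> {x \<in> topspace (sum_topology X I). f x \<in> U}}"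
    using openin_continuous_map_preimage[OF assms[OF i] U] by simp
qed auto

lemma compact_sum_topology:
  assumes "finite I" "\<And>i. i \<in> I \<Longrightarrow> compact_space (X i)"
  shows "compact_space (sum_topology X I)"
proof -
  have "compactin (sum_topology X I) (\<Union>i\<in>I. Pair i ` topspace (X i))"
    using assms
    by (intro compactin_Union) (auto simp: compact_space_def intro!: image_compactin
        intro: continuous_map_component_injection)
  moreover have "(\<Union>i\<in>I. Pair i ` topspace (X i)) = topspace (sum_topology X I)"
    by auto
  ultimately show ?thesis by (simp add: compact_space_def)
qed

section \<open>Polar angles and the arcs below the ovals\<close>

text \<open>Giving \<open>r\<close> the sign of \<open>y\<close> moves (x, y) / r to the closed
  upper half circle, so that angles below \<open>pi\<close> suffice.\<close>

lemma polar_half_plane: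
  fixes x y :: real
  assumes "x \<noteq> 0 \<or> y \<noteq> 0"
  obtains r t where "r \<noteq> 0" "0 \<le> t" "t < pi" "x = r * cos t" "y = r * sin t"
proof -
  define r where "r = (if y \<ge> 0 then sqrt (x\<^sup>2 + y\<^sup>2) else - sqrt (x\<^sup>2 + y\<^sup>2))"
  have pos: "x\<^sup>2 + y\<^sup>2 > 0"
    using assms by (simp add: sum_power2_gt_zero_iff)
  then have r: "r \<noteq> 0" "r\<^sup>2 = x\<^sup>2 + y\<^sup>2"
    by (auto simp: r_def)
  have "0 \<le> y / r"
    using pos by (auto simp: r_def divide_nonpos_pos)
  moreover have "(x / r)\<^sup>2 + (y / r)\<^sup>2 = 1"
    using r(1) by (simp add: power_divide flip: add_divide_distrib r(2))
  ultimately obtain t where t: "0 \<le> t" "t \<le> pi" "x / r = cos t" "y / r = sin t"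
    using sincos_total_pi by blast
  show ?thesis
  proof (cases "t = pi")
    \<comment> \<open>The endpoint \<open>pi\<close> spans the same line as angle 0, with the radius
      negated.\<close>
    case True
    with t r(1) show ?thesis
      by (intro that[of "- r" 0]) (auto simp: field_simps)
  next
    case False
    with t r(1) show ?thesis
      by (intro that[of r t]) (auto simp: field_simps)
  qed
qed

text \<open>The affine curve \<open>X\<^sub>0\<^sup>d = - 2 cos (d t)\<close>, where \<open>X\<^sub>1 + \<i> X\<^sub>2 = cis t\<close>, lies over the arcs where
  \<open>cos (d t) \<le> 0\<close>; the \<open>k\<close>-th of them is centred at \<open>(2 k + 1) pi / d\<close>. Over it the curve is
  parametrized by the point \<open>(a, b) = (\<plusminus> cos s, sin s)\<close> of the circle, where \<open>d t = (2 k + 1) pi + s\<close>.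
  Since \<open>root d\<close> is an odd function even for even \<open>d\<close>, the coordinate \<open>X\<^sub>0\<close> is \<open>root d (2 a)\<close>.\<close>

definition oval_angle :: "nat \<Rightarrow> nat \<Rightarrow> real \<Rightarrow> real" where
  "oval_angle d k s = ((2 * real k + 1) * pi + s) / real d"

lemma cos_oval_angle:
  assumes "d > 0"
  shows "cos (real d * oval_angle d k s) = - cos s"
proof -
  have "real d * oval_angle d k s = (2 * real k + 1) * pi + s"
    using assms by (simp add: oval_angle_def)
  also have "\<dots> = (s + pi) + 2 * real k * pi"
    by (simp add: algebra_simps)
  finally have "real d * oval_angle d k s = (s + pi) + 2 * real k * pi" .
  then show ?thesis
    by (simp only: cos_add[of "s + pi"] cos_2npi sin_2npi) simp
qed

text \<open>The numerator stays strictly between 0 and (2 k + 2) pi, which is at most d pi. Every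
  oval thus has positive X_2 in the chosen representatives, which later fixes the sign of a scaling
  factor.\<close>

lemma oval_angle_bounds:
  assumes "k < d div 2" "\<bar>s\<bar> \<le> pi / 2"
  shows "0 < oval_angle d k s" "oval_angle d k s < pi"
proof -
  have "2 * k + 2 \<le> d" using assms(1) by linarith
  then have k: "2 * real k + 2 \<le> real d" by linarith
  have expand: "(2 * real k + 1) * pi + s = 2 * real k * pi + pi + s"
    by (simp add: algebra_simps)
  have "0 \<le> 2 * real k * pi" by simp
  with expand have "0 < (2 * real k + 1) * pi + s"
    using assms(2) pi_gt_zero by linarith
  then show "0 < oval_angle d k s"
    using k by (simp add: oval_angle_def)
  have "(2 * real k + 2) * pi \<le> real d * pi"
    using k by (intro mult_right_mono) auto
  then have "2 * real k * pi + 2 * pi \<le> pi * real d"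
    by (simp add: algebra_simps)
  with expand have "(2 * real k + 1) * pi + s < pi * real d"
    using assms(2) pi_gt_zero by linarith
  then show "oval_angle d k s < pi"
    using k by (simp add: oval_angle_def divide_less_eq)
qed

text \<open>The arcs are disjoint: before division by \<open>d\<close>, centres are multiples of 2
  pi apart, while \<open>s\<close> and \<open>s'\<close> differ by at most pi.\<close>

lemma oval_angle_inj:
  assumes "d > 0" "\<bar>s\<bar> \<le> pi / 2" "\<bar>s'\<bar> \<le> pi / 2" "oval_angle d k s = oval_angle d k' s'"
  shows "k = k' \<and> s = s'"
proof -
  have eq: "(real k - real k') * (2 * pi) = s' - s"
    using assms(1,4) by (simp add: oval_angle_def algebra_simps)
  then have "\<bar>real k - real k'\<bar> * (2 * pi) = \<bar>s' - s\<bar>"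
    by (metis abs_mult abs_of_nonneg pi_ge_zero mult_nonneg_nonneg zero_le_numeral)
  also have "\<dots> < 1 * (2 * pi)"
    using assms(2,3) pi_gt_zero by linarith
  finally have "\<bar>real k - real k'\<bar> < 1"
    by (rule mult_right_less_imp_less) simp
  then have "k = k'" by linarith
  with eq show ?thesis by simp
qed

text \<open>\<open>k\<close> counts the full periods of the cosine before d t, and \<open>s\<close>
  is the offset from the midpoint of the current period, where the cosine is -1.\<close>

lemma exists_oval_angle:
  assumes "even d" "d > 0" "0 \<le> t" "t < pi" "cos (real d * t) \<le> 0"
  obtains k s where "k < d div 2" "\<bar>s\<bar> \<le> pi / 2" "t = oval_angle d k s"
proof -
  define k where "k = nat \<lfloor>real d * t / (2 * pi)\<rfloor>"
  define s where "s = real d * t - (2 * real k + 1) * pi"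
  have "0 \<le> real d * t / (2 * pi)" using assms by simp
  then have "real k \<le> real d * t / (2 * pi)" "real d * t / (2 * pi) < real k + 1"
    unfolding k_def by linarith+
  then have k: "real k * (2 * pi) \<le> real d * t" "real d * t < (real k + 1) * (2 * pi)"
    using pi_gt_zero by (simp_all add: field_simps)
  have "real k * (2 * pi) < real d * pi"
    using k(1) assms by (smt (verit) mult_strict_left_mono of_nat_0_less_iff)
  then have "2 * real k < real d"
    using pi_gt_zero by (simp add: algebra_simps)
  \<comment> \<open>Evenness matters: for odd \<open>d\<close>, 2 k < d would still allow k = d div
    2.\<close>
  then have "k < d div 2" using assms(1) by (auto elim!: evenE)
  moreover have t: "t = oval_angle d k s"
    using assms(2) by (simp add: oval_angle_def s_def)
  moreover have "\<bar>s\<bar> \<le> pi / 2"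
  proof (rule ccontr)
    assume "\<not> ?thesis"
    moreover have "\<bar>s\<bar> \<le> pi"
      using k by (simp add: s_def abs_le_iff algebra_simps)
    \<comment> \<open>An offset beyond pi / 2 makes cos s negative, hence cos (d t) = - cos s
      positive.\<close>
    ultimately have "cos \<bar>s\<bar> < cos (pi / 2)"
      by (intro cos_monotone_0_pi) auto
    then show False
      using assms(5) cos_oval_angle[OF assms(2), of k s] t by simp
  qed
  ultimately show ?thesis using that by blast
qed

text \<open>Over each arc the branches X_0 \<ge> 0 and X_0 \<le> 0 meet at the ends s = - pi / 2 and
  s = pi / 2, where X_0 = 0, and close up to a circle. On it \<open>v $ 2\<close> determines
  \<open>s\<close>, and the sign of \<open>v $ 1\<close> selects the branch.\<close>

lemma twisted_fermat_locus_even: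
  assumes "even d" "d > 0"
  shows "real_locus (twisted_fermat_form d) homeomorphic_space sum_topology (\<lambda>_. circle) {..<d div 2}"
proof (rule homeomorphic_real_locus_parametrization)
  let ?X = "sum_topology (\<lambda>_. circle) {..<d div 2}"
  define g where "g = (\<lambda>(k, v::real^2). coords (root d (2 * v $ 1))
      (cos (oval_angle d k (arcsin (v $ 2)))) (sin (oval_angle d k (arcsin (v $ 2)))))"
  show "compact_space ?X"
    by (intro compact_sum_topology compact_circle) auto
  have bound: "\<bar>v $ 2\<bar> \<le> 1" "\<bar>arcsin (v $ 2)\<bar> \<le> pi / 2" "(cos (arcsin (v $ 2)))\<^sup>2 = (v $ 1)\<^sup>2"
    "cos (arcsin (v $ 2)) \<ge> 0"
    if "v \<in> topspace circle" for v
  proof -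
    have v: "(v $ 1)\<^sup>2 + (v $ 2)\<^sup>2 = 1" using that by (simp add: topspace_circle)
    then have "(v $ 2)\<^sup>2 \<le> 1" using zero_le_power2[of "v $ 1"] by linarith
    then show 1: "\<bar>v $ 2\<bar> \<le> 1" by (simp add: abs_square_le_1)
    then show "\<bar>arcsin (v $ 2)\<bar> \<le> pi / 2"
      using arcsin_bounded[of "v $ 2"] by (auto simp: abs_le_iff)
    show "(cos (arcsin (v $ 2)))\<^sup>2 = (v $ 1)\<^sup>2"
      using 1 v by (simp add: cos_squared_eq)
    show "cos (arcsin (v $ 2)) \<ge> 0"
      using 1 by (auto simp: cos_arcsin abs_square_le_1)
  qed
  have "continuous_on (sphere 0 1) (\<lambda>v::real^2. arcsin (v $ 2))"
    using bound(1) by (intro continuous_intros) (auto simp: circle_def abs_le_iff)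
  then show "continuous_map ?X euclidean g"
    by (intro continuous_map_sum_topologyI)
      (auto simp: g_def circle_def oval_angle_def assms(2) intro!: continuous_intros)
  \<comment> \<open>For negative \<open>a\<close> the root is negative, so the identity is stated
    for absolute values; evenness of \<open>d\<close> removes the one on the root later.\<close>
  have abs_root: "\<bar>root d (2 * a)\<bar> ^ d = 2 * \<bar>a\<bar>" for a
    using assms(2) by (simp add: abs_mult flip: real_root_abs)
  show "g x \<noteq> 0 \<and> twisted_fermat_form d (g x) = 0" if x: "x \<in> topspace ?X" for x
  proof -
    obtain k v where kv: "x = (k, v)" "v \<in> topspace circle" using x by auto
    define t where "t = oval_angle d k (arcsin (v $ 2))"
    have g: "g x = coords (root d (2 * v $ 1)) (cos t) (sin t)"
      by (simp add: g_def kv t_def)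
    have "g x \<noteq> 0"
      unfolding g vec3_eq_iff by (simp add: sin_zero_abs_cos_one) (metis abs_0 sin_zero_abs_cos_one zero_neq_one)
    moreover have "(cos (arcsin (v $ 2))) = \<bar>v $ 1\<bar>"
      using bound(3,4)[OF kv(2)] by (metis abs_of_nonneg power2_eq_iff abs_ge_zero power2_abs power2_eq_imp_eq)
    then have "cos (real d * t) = - \<bar>v $ 1\<bar>"
      by (simp add: t_def cos_oval_angle assms(2))
    moreover have "root d (2 * v $ 1) ^ d = 2 * \<bar>v $ 1\<bar>"
      using abs_root[of "v $ 1"] assms(1) by (simp add: power_even_abs)
    ultimately show ?thesis
      using twisted_fermat_form_polar[of "g x" 1 t d] by (simp add: g)
  qed
  show "x = y" if xy: "x \<in> topspace ?X" "y \<in> topspace ?X" "c \<noteq> 0" "g x = c *\<^sub>R g y" for x y c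
  proof -
    obtain k v where kv: "x = (k, v)" "v \<in> topspace circle" "k < d div 2" using xy(1) by auto
    obtain l w where lw: "y = (l, w)" "w \<in> topspace circle" "l < d div 2" using xy(2) by auto
    define t where "t = oval_angle d k (arcsin (v $ 2))"
    define u where "u = oval_angle d l (arcsin (w $ 2))"
    have eq: "root d (2 * v $ 1) = c * root d (2 * w $ 1)" "cos t = c * cos u" "sin t = c * sin u"
      using xy(4) by (auto simp: g_def kv lw t_def u_def vec3_eq_iff)
    have tu: "0 < t" "t < pi" "0 < u" "u < pi"
      unfolding t_def u_def using oval_angle_bounds kv lw bound(2) by blast+
    \<comment> \<open>Unit vectors again give \<open>c\<close> = 1 or -1, and both sines are
      positive on (0, pi). Then the cosine determines the angle, the angle determines
      \<open>k\<close> and \<open>s\<close>, and X_0 determines \<open>v $ 1\<close>.\<close>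
    have "1 = c\<^sup>2 * ((cos u)\<^sup>2 + (sin u)\<^sup>2)"
      by (simp only: distrib_left flip: power_mult_distrib eq) simp
    then have "c\<^sup>2 = 1" by simp
    moreover have "c > 0"
      using eq(3) tu sin_gt_zero by (metis zero_less_mult_pos2)
    ultimately have c: "c = 1" by (simp add: power2_eq_1_iff)
    have "t = u"
      using eq(2) c tu by (metis arccos_cos less_imp_le mult_1)
    then have "k = l \<and> arcsin (v $ 2) = arcsin (w $ 2)"
      unfolding t_def u_def using assms(2) kv lw bound(2) by (intro oval_angle_inj) auto
    moreover have "v $ 1 = w $ 1"
      using eq(1) c assms(2) by simp
    ultimately show ?thesis
      using bound(1) kv lw by (auto simp: vec2_eq_iff arcsin_eq_iff)
  qed
  show "\<exists>x\<in>topspace ?X. \<exists>c. c \<noteq> 0 \<and> v = c *\<^sub>R g x" if v: "v \<noteq> 0" "twisted_fermat_form d v = 0" for v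
  proof -
    \<comment> \<open>At radius 0 the polar equation reduces to X_0^d = 0.\<close>
    have "v $ 1 \<noteq> 0 \<or> v $ 2 \<noteq> 0"
      using v twisted_fermat_form_polar[of v 0 0 d] assms(2) by (auto simp: vec3_eq_iff power_0_left simp del: of_real_add)
    then obtain r t where rt: "r \<noteq> 0" "0 \<le> t" "t < pi" "v $ 1 = r * cos t" "v $ 2 = r * sin t"
      by (rule polar_half_plane)
    \<comment> \<open>\<open>a\<close> is X_0 after rescaling (X_1, X_2) to a unit vector.\<close>
    define a where "a = v $ 0 / r"
    have "(v $ 0) ^ d + 2 * r ^ d * cos (real d * t) = 0"
      using v(2) twisted_fermat_form_polar[OF rt(4,5)] of_real_eq_0_iff by metis
    then have a: "a ^ d = - 2 * cos (real d * t)"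
      using rt(1) by (simp add: a_def power_divide field_simps)
    then have "cos (real d * t) \<le> 0"
      using zero_le_even_power[OF assms(1), of a] by linarith
    then obtain k s where ks: "k < d div 2" "\<bar>s\<bar> \<le> pi / 2" "t = oval_angle d k s"
      using exists_oval_angle assms rt(2,3) by blast
    have ad: "\<bar>a\<bar> ^ d = 2 * cos s"
      using a ks(3) assms by (simp add: cos_oval_angle power_even_abs)
    define x :: "real^2" where "x = vector [sgn a * cos s, sin s]"
    \<comment> \<open>Since \<open>sgn 0 = 0\<close>, the case \<open>a = 0\<close> gives a point of
      the circle only because cos s vanishes there.\<close>
    have "a \<noteq> 0 \<or> cos s = 0"
      using ad assms(2) by (auto simp: power_0_left)
    then have "x \<in> topspace circle"
      by (auto simp: topspace_circle x_def power_mult_distrib sgn_if) (metis sin_cos_squared_add add_0_right zero_power2)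
    moreover have "arcsin (x $ 2) = s"
      using ks(2) by (simp add: x_def arcsin_sin abs_le_iff)
    moreover have "root d (2 * x $ 1) = a"
    proof -
      have "2 * x $ 1 = sgn a * \<bar>a\<bar> ^ d" by (simp add: x_def ad)
      then show ?thesis using assms(2) by (simp add: root_sgn_power)
    qed
    ultimately have "(k, x) \<in> topspace ?X" "v = r *\<^sub>R g (k, x)"
      using ks rt by (auto simp: g_def vec3_eq_iff a_def)
    then show ?thesis using rt(1) by blast
  qed
qed

theorem theorem6p5:
  fixes d :: nat
  assumes "d > 0"
  shows
    "(odd d \<longrightarrow>
        real_locus (fermat_form d) homeomorphic_space (real_projective_space :: (real^2) set topology) \<and>
        real_locus (twisted_fermat_form d) homeomorphic_space (real_projective_space :: (real^2) set topology)) \<and>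
     (even d \<longrightarrow>
        topspace (real_locus (fermat_form d)) = {} \<and>
        real_locus (signed_fermat_form d) homeomorphic_space circle \<and>
        real_locus (twisted_fermat_form d) homeomorphic_space sum_topology (\<lambda>_. circle) {..<d div 2})"
  using assms fermat_locus_odd twisted_fermat_locus_odd fermat_locus_even signed_fermat_locus_even
    twisted_fermat_locus_even by blast

end
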